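(* Let $M$ be a submanifold of $\mathbb{R}^{n}$ and let $X \subset \mathbb{R}^n$ be a subset such that $\dim_{B} X < n - \dim M - 1$ and $M \cap X = \emptyset$. Then: (1) there exists a motion $\mu : M \times [0,1] \to \mathbb{R}^n$ of $M$ in $\mathbb{R}^n$ such that all paths are disjoint from $X$, that is, $\mu(x,t) \notin X$ for all $x \in M$ and $t \in [0,1]$; (2) given $x_{0} \in M$ and $y_{0} \in \mathbb{R}^{n} \setminus X$, the motion in (1) can be chosen in such a way that the target of $x_{0}$ is equal to $y_{0}$, that is, $\mu(x_0,1) = y_0$.
   Context: Motion: for a subset $A \subset \mathbb{R}^{n}$, a motion of $A$ in $\mathbb{R}^{n}$ is a continuous map $\mu : A \times [0,1] \to \mathbb{R}^{n}$ such that $\mu(a,0)=a$ for all $a \in A$ and, for every $t \in [0,1]$, the map $A \to \mu(A,t)$, $a \mapsto \mu(a,t)$, is an isometry. For fixed $a \in A$ the map $\mu_a : [0,1] \to \mathbb{R}^n$, $\mu_a(t) = \mu(a,t)$, is called the path of $a$. Box dimension: for a bounded subset $A$ of a metric space, let $m_\delta(A)$ be the maximum number of disjoint balls of radius $\delta$ with centers contained in $A$. The upper box dimension of $A$ is $\limsup_{\delta \to 0} \frac{\log m_\delta(A)}{-\log \delta}$ and the lower box dimension is the corresponding $\liminf$. If they are equal, the common value is the box dimension $\dim_B(A)$. If $A$ is not bounded, $\dim_B A = \max\{\dim_B(A \cap U) : U \text{ a bounded open set}\}$. It is assumed throughout that the box dimensions considered exist. $\dim M$ denotes the topological dimension of $M$.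 *)

theory Defs
  imports "HOL-Analysis.Analysis"
begin

subsection \<open>Submanifolds\<close>

definition C1_on :: "('a::real_normed_vector \<Rightarrow> 'b::real_normed_vector) \<Rightarrow> 'a set \<Rightarrow> bool"
  where "C1_on f U \<longleftrightarrow>
    (\<exists>f'. (\<forall>x\<in>U. (f has_derivative blinfun_apply (f' x)) (at x)) \<and> continuous_on U f')"

definition C1_diffeomorphism ::
    "'a::real_normed_vector set \<Rightarrow> 'b::real_normed_vector set \<Rightarrow> ('a \<Rightarrow> 'b) \<Rightarrow> ('b \<Rightarrow> 'a) \<Rightarrow> bool"
  where "C1_diffeomorphism U V f g \<longleftrightarrow>
    open U \<and> open V \<and> homeomorphism U V f g \<and> C1_on f U \<and> C1_on g V"

text \<open>Embedded submanifolds without boundary, not assumed closed, connected or compact. Only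
  continuous differentiability is asked for, so submanifolds of every class \<open>C^r\<close> with
  \<open>1 \<le> r \<le> \<infinity>\<close> are included. The dimension \<open>k\<close> is determined by \<open>M\<close> unless \<open>M\<close> is empty.\<close>

definition submanifold :: "nat \<Rightarrow> 'a::euclidean_space set \<Rightarrow> bool"
  where "submanifold k M \<longleftrightarrow>
    (\<forall>p\<in>M. \<exists>U V f g L. p \<in> U \<and> C1_diffeomorphism U V f g \<and>
       subspace (L :: 'a set) \<and> dim L = k \<and> f ` (M \<inter> U) = L \<inter> V)"

subsection \<open>Motions\<close>

definition motion :: "'a::metric_space set \<Rightarrow> ('a \<times> real \<Rightarrow> 'a) \<Rightarrow> bool"
  where "motion A \<mu> \<longleftrightarrow>
    continuous_on (A \<times> {0..1}) \<mu> \<and>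
    (\<forall>a\<in>A. \<mu> (a, 0) = a) \<and>
    (\<forall>t\<in>{0..1}. \<forall>a\<in>A. \<forall>b\<in>A. dist (\<mu> (a, t)) (\<mu> (b, t)) = dist a b)"

subsection \<open>Box dimension\<close>

text \<open>The supremum is an attained maximum when \<open>A\<close> is totally bounded, in particular for
  bounded subsets of a Euclidean space.\<close>

definition packing_number :: "'a::metric_space set \<Rightarrow> real \<Rightarrow> enat"
  where "packing_number A \<delta> =
    (SUP S \<in> {S. finite S \<and> S \<subseteq> A \<and> pairwise (\<lambda>x y. disjnt (ball x \<delta>) (ball y \<delta>)) S}.
       enat (card S))"

text \<open>With \<open>log 0 = -\<infinity>\<close>, the box dimension of the empty set is \<open>-\<infinity>\<close>.\<close>

definition log_enat :: "enat \<Rightarrow> ereal"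
  where "log_enat m =
    (case m of enat j \<Rightarrow> (if j = 0 then -\<infinity> else ereal (ln (real j))) | \<infinity> \<Rightarrow> \<infinity>)"

definition upper_box_dim :: "'a::metric_space set \<Rightarrow> ereal"
  where "upper_box_dim A =
    Limsup (at_right 0) (\<lambda>\<delta>. log_enat (packing_number A \<delta>) / ereal (- ln \<delta>))"

definition lower_box_dim :: "'a::metric_space set \<Rightarrow> ereal"
  where "lower_box_dim A =
    Liminf (at_right 0) (\<lambda>\<delta>. log_enat (packing_number A \<delta>) / ereal (- ln \<delta>))"

definition bounded_has_box_dim :: "'a::metric_space set \<Rightarrow> ereal \<Rightarrow> bool"
  where "bounded_has_box_dim A d \<longleftrightarrow> upper_box_dim A = d \<and> lower_box_dim A = d"

text \<open>\<open>has_box_dim A d\<close> says that the box dimension of \<open>A\<close> exists and equals \<open>d\<close>. For unbounded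
  \<open>A\<close> this includes the existence of the box dimensions of all the pieces \<open>A \<inter> U\<close> and of their
  maximum.\<close>

definition has_box_dim :: "'a::metric_space set \<Rightarrow> ereal \<Rightarrow> bool"
  where "has_box_dim A d \<longleftrightarrow>
    (if bounded A then bounded_has_box_dim A d
     else (\<forall>U. open U \<and> bounded U \<longrightarrow> (\<exists>e. bounded_has_box_dim (A \<inter> U) e \<and> e \<le> d)) \<and>
          (\<exists>U. open U \<and> bounded U \<and> bounded_has_box_dim (A \<inter> U) d))"

end

theory Submission
  imports Defs
begin

text \<open>For (1) the constant motion will do. For (2) take
  \<open>\<mu> (x, t) = x\<^sub>0 + t (y\<^sub>0 - x\<^sub>0) + R\<^sub>t (x - x\<^sub>0) + t (1 - t) v\<close> with a path of rotations
  \<open>R\<^sub>t\<close> starting at the identity. The vectors \<open>v\<close> for which some point of \<open>M\<close> meets \<open>X\<close> at a time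
  \<open>0 < t < 1\<close> form a countable union of Lipschitz images of pieces of \<open>X \<times> M \<times> (0, 1)\<close>, whose
  box dimension is below \<open>n\<close>, so almost every \<open>v\<close> is good. It remains to choose \<open>R\<^sub>1\<close> such that
  the final position avoids \<open>X\<close>. It is an even product of generic reflections: the
  reflection exchanging two distinct points \<open>y\<close>, \<open>z\<close> of equal norm has normal \<open>y - z\<close>, so by the
  same count a generic reflection makes no new coincidences, and only points fixed by all the
  reflections could meet \<open>X\<close>.\<close>

subsection \<open>Covering rates\<close>

text \<open>A quantitative form of upper box dimension at most \<open>e\<close>. Covers suit
  Lipschitz images and products better than packings do. The centres may lie anywhere in the space,
  and the free constant \<open>C\<close> absorbs changes of scale. A finite cover by balls also
  makes \<open>A\<close> bounded.\<close>

definition covering_rate :: "real \<Rightarrow> 'a::metric_space set \<Rightarrow> bool"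
  where "covering_rate e A \<longleftrightarrow>
    (\<exists>C\<ge>0. \<forall>\<^sub>F \<delta> in at_right 0.
       \<exists>S. finite S \<and> real (card S) \<le> C * \<delta> powr (- e) \<and> A \<subseteq> (\<Union>x\<in>S. cball x \<delta>))"

section \<open>Subsets, changes of scale, Lipschitz images and products\<close>

lemma covering_rate_subset:
  assumes "covering_rate e B" "A \<subseteq> B"
  shows "covering_rate e A"
proof -
  obtain C where "C \<ge> 0" and ev: "\<forall>\<^sub>F \<delta> in at_right (0::real).
       \<exists>S. finite S \<and> real (card S) \<le> C * \<delta> powr (- e) \<and> B \<subseteq> (\<Union>x\<in>S. cball x \<delta>)"
    using assms(1) unfolding covering_rate_def by blast
  have "\<forall>\<^sub>F \<delta> in at_right (0::real).
       \<exists>S. finite S \<and> real (card S) \<le> C * \<delta> powr (- e) \<and> A \<subseteq> (\<Union>x\<in>S. cball x \<delta>)"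
    using ev by (rule eventually_mono) (meson assms(2) order_trans)
  then show ?thesis
    using \<open>C \<ge> 0\<close> unfolding covering_rate_def by blast
qed

lemma covering_rate_bounded:
  assumes "covering_rate e A"
  shows "bounded A"
proof -
  obtain C where ev: "\<forall>\<^sub>F \<delta> in at_right (0::real).
       \<exists>S. finite S \<and> real (card S) \<le> C * \<delta> powr (- e) \<and> A \<subseteq> (\<Union>x\<in>S. cball x \<delta>)"
    using assms unfolding covering_rate_def by blast
  obtain \<delta> S where "finite S" "A \<subseteq> (\<Union>x\<in>S. cball x \<delta>)"
    using eventually_happens'[OF trivial_limit_at_right_real ev] by blast
  then show ?thesis
    by (meson bounded_UN bounded_cball bounded_subset)
qed

lemma filterlim_mult_at_right_0:
  assumes "c > (0::real)"
  shows "filterlim (\<lambda>\<delta>. \<delta> * c) (at_right 0) (at_right 0)"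
  unfolding filterlim_at
proof
  show "\<forall>\<^sub>F x in at_right 0. x * c \<in> {0<..} \<and> x * c \<noteq> 0"
    using eventually_at_right_less by eventually_elim (use assms in auto)
  show "((\<lambda>x. x * c) \<longlongrightarrow> 0) (at_right 0)"
    by (auto intro!: tendsto_eq_intros)
qed

text \<open>Substituting \<open>\<delta> / K\<close> for \<open>\<delta>\<close> only multiplies the
  constant by a power of \<open>K\<close>. Later covers may therefore use any fixed multiple of
  \<open>\<delta>\<close> as radius.\<close>

lemma covering_rate_rescale:
  fixes A :: "'a::metric_space set"
  assumes "K > 0" "C \<ge> 0"
    and ev: "\<forall>\<^sub>F \<delta> in at_right 0.
       \<exists>S. finite S \<and> real (card S) \<le> C * \<delta> powr (- e) \<and> A \<subseteq> (\<Union>x\<in>S. cball x (K * \<delta>))"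
  shows "covering_rate e A"
proof -
  have "\<forall>\<^sub>F \<delta> in at_right 0. \<exists>S. finite S \<and>
      real (card S) \<le> C * (\<delta> * inverse K) powr (- e) \<and> A \<subseteq> (\<Union>x\<in>S. cball x (K * (\<delta> * inverse K)))"
    using eventually_compose_filterlim[OF ev filterlim_mult_at_right_0[of "inverse K"]] \<open>K > 0\<close>
    by auto
  moreover have "\<forall>\<^sub>F \<delta> in at_right (0::real). \<delta> > 0"
    by (rule eventually_at_right_less)
  ultimately have "\<forall>\<^sub>F \<delta> in at_right 0. \<exists>S. finite S \<and>
      real (card S) \<le> C * inverse K powr (- e) * \<delta> powr (- e) \<and> A \<subseteq> (\<Union>x\<in>S. cball x \<delta>)"
  proof eventually_elim
    case (elim \<delta>)
    then have "K * (\<delta> * inverse K) = \<delta>" "(\<delta> * inverse K) powr (- e) = \<delta> powr (- e) * inverse K powr (- e)"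
      using \<open>K > 0\<close> by (auto simp: powr_mult)
    then show ?case using elim by (simp only: mult_ac)
  qed
  then show ?thesis
    unfolding covering_rate_def using \<open>C \<ge> 0\<close> by (intro exI[of _ "C * inverse K powr (- e)"]) auto
qed

lemma covering_rate_lipschitz_image:
  assumes "covering_rate e A" "L-lipschitz_on A f"
  shows "covering_rate e (f ` A)"
proof -
  have L: "L \<ge> 0" using assms(2) by (rule lipschitz_on_nonneg)
  obtain C where "C \<ge> 0" and ev: "\<forall>\<^sub>F \<delta> in at_right (0::real).
       \<exists>S. finite S \<and> real (card S) \<le> C * \<delta> powr (- e) \<and> A \<subseteq> (\<Union>x\<in>S. cball x \<delta>)"
    using assms(1) unfolding covering_rate_def by blast
  show ?thesis
  \<comment> \<open>The factor 2 pays for moving each centre into \<open>A\<close>;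
    \<open>L + 1\<close> instead of \<open>L\<close> keeps the scale positive when
    \<open>L = 0\<close>.\<close>
  proof (rule covering_rate_rescale[of "2 * (L + 1)" C])
    show "\<forall>\<^sub>F \<delta> in at_right (0::real). \<exists>S. finite S \<and> real (card S) \<le> C * \<delta> powr (- e) \<and>
        f ` A \<subseteq> (\<Union>x\<in>S. cball x (2 * (L + 1) * \<delta>))"
      using ev eventually_at_right_less
    proof eventually_elim
      case (elim \<delta>)
      then obtain S where S: "finite S" "real (card S) \<le> C * \<delta> powr (- e)" "A \<subseteq> (\<Union>x\<in>S. cball x \<delta>)"
        by auto
      \<comment> \<open>A centre may lie outside \<open>A\<close>, where \<open>f\<close> is not
        controlled, so it is replaced by a point of \<open>A\<close> in its ball. If the ball misses
        \<open>A\<close>, the value of \<open>p\<close> is arbitrary and harmless.\<close>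
      define p where "p x = f (SOME a. a \<in> A \<inter> cball x \<delta>)" for x
      have "f a \<in> (\<Union>y\<in>p ` S. cball y (2 * (L + 1) * \<delta>))" if a: "a \<in> A" for a
      proof -
        obtain x where x: "x \<in> S" "a \<in> cball x \<delta>" using S(3) a by auto
        define b where "b = (SOME a. a \<in> A \<inter> cball x \<delta>)"
        have "\<exists>a. a \<in> A \<inter> cball x \<delta>" using x a by blast
        then have "b \<in> A \<inter> cball x \<delta>"
          unfolding b_def by (rule someI_ex)
        then have b: "b \<in> A" "dist x b \<le> \<delta>" by auto
        have "dist (f b) (f a) \<le> L * dist b a"
          using lipschitz_onD[OF assms(2)] a b by auto
        also have "dist b a \<le> 2 * \<delta>"
          using b x dist_triangle[of b a x] by (auto simp: dist_commute)
        also have "L * (2 * \<delta>) \<le> 2 * (L + 1) * \<delta>"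
          using elim by (simp add: algebra_simps)
        finally have "dist (p x) (f a) \<le> 2 * (L + 1) * \<delta>"
          using L by (simp add: p_def b_def mult_left_mono)
        then show ?thesis using x by auto
      qed
      moreover have "real (card (p ` S)) \<le> C * \<delta> powr (- e)"
        using S(1,2) card_image_le[of S p] by linarith
      ultimately show ?case
        using S(1) by (intro exI[of _ "p ` S"]) auto
    qed
  qed (use L \<open>C \<ge> 0\<close> in auto)
qed

text \<open>Pairs of centres form a cover: the counts multiply, so the exponents add. The distance
  of two pairs is at most the sum of the coordinate distances, hence radius
  \<open>2 * \<delta>\<close>.\<close>

lemma covering_rate_Times:
  assumes "covering_rate d A" "covering_rate e B"
  shows "covering_rate (d + e) (A \<times> B)"
proof -
  obtain C where "C \<ge> 0" and ev: "\<forall>\<^sub>F \<delta> in at_right (0::real).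
       \<exists>S. finite S \<and> real (card S) \<le> C * \<delta> powr (- d) \<and> A \<subseteq> (\<Union>x\<in>S. cball x \<delta>)"
    using assms(1) unfolding covering_rate_def by blast
  obtain D where "D \<ge> 0" and ev': "\<forall>\<^sub>F \<delta> in at_right (0::real).
       \<exists>S. finite S \<and> real (card S) \<le> D * \<delta> powr (- e) \<and> B \<subseteq> (\<Union>x\<in>S. cball x \<delta>)"
    using assms(2) unfolding covering_rate_def by blast
  show ?thesis
  proof (rule covering_rate_rescale[of 2 "C * D"])
    show "\<forall>\<^sub>F \<delta> in at_right (0::real). \<exists>S. finite S \<and> real (card S) \<le> C * D * \<delta> powr (- (d + e)) \<and>
        A \<times> B \<subseteq> (\<Union>x\<in>S. cball x (2 * \<delta>))"
      using ev ev'
    proof eventually_elim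
      case (elim \<delta>)
      then obtain S T where S: "finite S" "real (card S) \<le> C * \<delta> powr (- d)" "A \<subseteq> (\<Union>x\<in>S. cball x \<delta>)"
        and T: "finite T" "real (card T) \<le> D * \<delta> powr (- e)" "B \<subseteq> (\<Union>x\<in>T. cball x \<delta>)"
        by auto
      have "real (card (S \<times> T)) \<le> (C * \<delta> powr (- d)) * (D * \<delta> powr (- e))"
        unfolding card_cartesian_product of_nat_mult using S(2) T(2) by (intro mult_mono) auto
      also have "\<dots> = C * D * \<delta> powr (- (d + e))"
        by (simp add: powr_add[symmetric] mult_ac add_ac)
      finally have "real (card (S \<times> T)) \<le> C * D * \<delta> powr (- (d + e))" .
      moreover have "A \<times> B \<subseteq> (\<Union>x\<in>S \<times> T. cball x (2 * \<delta>))"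
      proof clarify
        fix a b assume "a \<in> A" "b \<in> B"
        then obtain x y where "x \<in> S" "a \<in> cball x \<delta>" "y \<in> T" "b \<in> cball y \<delta>"
          using S(3) T(3) by blast
        then have xy: "x \<in> S" "dist x a \<le> \<delta>" "y \<in> T" "dist y b \<le> \<delta>"
          by auto
        have "dist (x, y) (a, b) \<le> dist x a + dist y b"
          unfolding dist_Pair_Pair by (rule sqrt_sum_squares_le_sum) auto
        then show "(a, b) \<in> (\<Union>x\<in>S \<times> T. cball x (2 * \<delta>))"
          using xy by (intro UN_I[of "(x, y)"]) auto
      qed
      ultimately show ?case
        using S(1) T(1) by (intro exI[of _ "S \<times> T"]) auto
    qed
  qed (use \<open>C \<ge> 0\<close> \<open>D \<ge> 0\<close> in auto)
qed

section \<open>Covering rates of intervals and of bounded pieces of subspaces\<close>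

lemma covering_rate_Icc: "covering_rate 1 {a..b::real}"
proof -
  \<comment> \<open>For \<open>\<delta> < 1\<close> the additive 2 from rounding up and from the
    initial grid point is at most \<open>2 / \<delta>\<close>.\<close>
  have "\<forall>\<^sub>F \<delta> in at_right (0::real). \<delta> < 1"
    by (rule eventually_at_right_real[THEN eventually_mono]) auto
  with eventually_at_right_less[of "0::real"]
  have "\<forall>\<^sub>F \<delta> in at_right (0::real). \<exists>S. finite S \<and>
      real (card S) \<le> (\<bar>b - a\<bar> + 2) * \<delta> powr (- 1) \<and> {a..b} \<subseteq> (\<Union>x\<in>S. cball x \<delta>)"
  proof eventually_elim
    case (elim \<delta>)
    define N where "N = nat \<lceil>\<bar>b - a\<bar> / \<delta>\<rceil>"
    define S where "S = (\<lambda>i. a + real i * \<delta>) ` {..N}"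
    have "real N \<le> \<bar>b - a\<bar> / \<delta> + 1"
      unfolding N_def using elim by (simp add: ceiling_correct le_of_int_ceiling)
    then have "real (N + 1) \<le> \<bar>b - a\<bar> / \<delta> + 2 / \<delta>"
      using elim by (simp add: field_simps)
    moreover have "card S \<le> N + 1"
      unfolding S_def using card_image_le[of "{..N}"] by force
    ultimately have "real (card S) \<le> (\<bar>b - a\<bar> + 2) * \<delta> powr (- 1)"
      using elim by (simp add: powr_minus divide_inverse distrib_right)
    moreover have "x \<in> (\<Union>x\<in>S. cball x \<delta>)" if x: "x \<in> {a..b}" for x
    proof -
      define i where "i = nat \<lfloor>(x - a) / \<delta>\<rfloor>"
      have nn: "(x - a) / \<delta> \<ge> 0" using x elim by auto
      then have i: "real i \<le> (x - a) / \<delta>" "(x - a) / \<delta> < real i + 1"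
        unfolding i_def by auto
      have "(x - a) / \<delta> \<le> \<bar>b - a\<bar> / \<delta>" using x elim by (intro divide_right_mono) auto
      then have "real i \<le> real N" using i(1) unfolding N_def by linarith
      moreover have "dist (a + real i * \<delta>) x \<le> \<delta>"
        using i elim by (simp add: dist_real_def field_simps)
      ultimately show ?thesis unfolding S_def by auto
    qed
    ultimately show ?case unfolding S_def by (intro exI[of _ S]) (auto simp: S_def)
  qed
  then show ?thesis
    unfolding covering_rate_def by (intro exI[of _ "\<bar>b - a\<bar> + 2"]) auto
qed

text \<open>By Cauchy-Schwarz, the coordinates in an orthonormal basis are bounded by
  \<open>r\<close>. The resulting coordinate box is built one axis at a time, as a Lipschitz image
  of an interval times the smaller box, and each axis adds 1 to the rate.\<close>

lemma covering_rate_bounded_subspace: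
  fixes L :: "'a::euclidean_space set"
  assumes "subspace L"
  shows "covering_rate (dim L) (L \<inter> cball 0 r)"
proof -
  obtain B where B: "B \<subseteq> L" "pairwise orthogonal B" "\<And>x. x \<in> B \<Longrightarrow> norm x = 1"
      "independent B" "card B = dim L" "span B = L"
    using orthonormal_basis_subspace[OF assms] by metis
  have "finite B" using B(4) by (rule independent_imp_finite)
  then have cov: "covering_rate (card B) {\<Sum>b\<in>B. u b *\<^sub>R b | u. \<forall>b\<in>B. \<bar>u b\<bar> \<le> r}"
  proof (induction B)
    case empty
    have "covering_rate 0 {0::'a}"
      unfolding covering_rate_def
      by (intro exI[of _ 1] conjI eventually_mono[OF eventually_at_right_less] exI[of _ "{0}"]) auto
    then show ?case by simp
  next
    case (insert b B)
    let ?S = "{\<Sum>b\<in>B. u b *\<^sub>R b | u. \<forall>b\<in>B. \<bar>u b\<bar> \<le> r}"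
    have "(norm b + 1)-lipschitz_on ({-r..r} \<times> ?S) (\<lambda>(t, s). t *\<^sub>R b + s)"
    proof (rule lipschitz_onI, clarsimp simp only: case_prod_conv)
      fix t t' and s s' :: 'a
      have "dist (t *\<^sub>R b + s) (t' *\<^sub>R b + s') \<le> norm ((t - t') *\<^sub>R b) + norm (s - s')"
        unfolding dist_norm using norm_triangle_ineq[of "(t - t') *\<^sub>R b" "s - s'"]
        by (simp add: algebra_simps)
      also have "\<dots> \<le> norm b * dist (t, s) (t', s') + dist (t, s) (t', s')"
        using dist_fst_le[of "(t,s)" "(t',s')"] dist_snd_le[of "(t,s)" "(t',s')"]
        by (intro add_mono) (auto simp: dist_norm mult.commute intro!: mult_left_mono)
      finally show "dist (t *\<^sub>R b + s) (t' *\<^sub>R b + s') \<le> (norm b + 1) * dist (t, s) (t', s')"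
        by (simp add: algebra_simps)
    qed auto
    then have "covering_rate (1 + real (card B)) ((\<lambda>(t, s). t *\<^sub>R b + s) ` ({-r..r} \<times> ?S))"
      using covering_rate_lipschitz_image[OF covering_rate_Times[OF covering_rate_Icc insert.IH]]
      by blast
    moreover have "{\<Sum>b\<in>insert b B. u b *\<^sub>R b | u. \<forall>b\<in>insert b B. \<bar>u b\<bar> \<le> r} \<subseteq>
        (\<lambda>(t, s). t *\<^sub>R b + s) ` ({-r..r} \<times> ?S)"
    proof clarify
      fix u assume u: "\<forall>b\<in>insert b B. \<bar>u b\<bar> \<le> r"
      show "(\<Sum>b\<in>insert b B. u b *\<^sub>R b) \<in> (\<lambda>(t, s). t *\<^sub>R b + s) ` ({-r..r} \<times> ?S)"
        using u insert.hyps
        by (intro image_eqI[of _ _ "(u b, \<Sum>b\<in>B. u b *\<^sub>R b)"]) (auto simp: abs_le_iff)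
    qed
    ultimately show ?case
      using insert.hyps by (auto intro: covering_rate_subset simp: add.commute)
  qed
  have "L \<inter> cball 0 r \<subseteq> {\<Sum>b\<in>B. u b *\<^sub>R b | u. \<forall>b\<in>B. \<bar>u b\<bar> \<le> r}"
  proof
    fix x assume x: "x \<in> L \<inter> cball 0 r"
    have "x = (\<Sum>b\<in>B. (b \<bullet> x) *\<^sub>R b)"
    proof -
      obtain u where u: "x = (\<Sum>b\<in>B. u b *\<^sub>R b)"
        using x B(6) \<open>finite B\<close> by (auto simp: span_finite)
      have "b \<bullet> x = u b" if "b \<in> B" for b
      proof -
        have "b \<bullet> x = (\<Sum>c\<in>B. u c * (b \<bullet> c))"
          by (simp add: u inner_sum_right)
        also have "\<dots> = (\<Sum>c\<in>B. if c = b then u c else 0)"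
          using that B(2,3) by (intro sum.cong) (auto simp: pairwise_def orthogonal_def norm_eq_1)
        also have "\<dots> = u b"
          using that \<open>finite B\<close> by simp
        finally show ?thesis .
      qed
      then show ?thesis using u by simp
    qed
    moreover have "\<bar>b \<bullet> x\<bar> \<le> r" if "b \<in> B" for b
      using Cauchy_Schwarz_ineq2[of b x] B(3)[OF that] x by simp
    ultimately show "x \<in> {\<Sum>b\<in>B. u b *\<^sub>R b | u. \<forall>b\<in>B. \<bar>u b\<bar> \<le> r}"
      by (auto intro!: exI[of _ "\<lambda>b. b \<bullet> x"])
  qed
  then show ?thesis using covering_rate_subset[OF cov] B(5) by simp
qed

text \<open>The covering balls have total volume at most a constant times
  \<open>\<delta> powr (DIM('a) - e)\<close>, which tends to 0.\<close>

lemma negligible_covering_rate: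
  fixes A :: "'a::euclidean_space set"
  assumes "covering_rate e A" "e < DIM('a)"
  shows "negligible A"
  unfolding negligible_outer
proof (intro allI impI)
  fix \<epsilon> :: real assume "\<epsilon> > 0"
  obtain C where "C \<ge> 0" and ev: "\<forall>\<^sub>F \<delta> in at_right (0::real).
       \<exists>S. finite S \<and> real (card S) \<le> C * \<delta> powr (- e) \<and> A \<subseteq> (\<Union>x\<in>S. cball x \<delta>)"
    using assms(1) unfolding covering_rate_def by blast
  let ?V = "unit_ball_vol (real DIM('a))"
  have "((\<lambda>\<delta>. C * ?V * \<delta> powr (DIM('a) - e)) \<longlongrightarrow> C * ?V * 0) (at_right (0::real))"
    using assms(2) by (intro tendsto_intros tendsto_zero_powrI)
      (auto simp: eventually_at_filter)
  then have small: "\<forall>\<^sub>F \<delta> in at_right (0::real). C * ?V * \<delta> powr (DIM('a) - e) < \<epsilon>"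
    using \<open>\<epsilon> > 0\<close> by (auto dest!: order_tendstoD(2)[of _ _ _ \<epsilon>])
  then obtain \<delta> S where S: "finite S" "real (card S) \<le> C * \<delta> powr (- e)" "A \<subseteq> (\<Union>x\<in>S. cball x \<delta>)"
    and \<delta>: "\<delta> > 0" "C * ?V * \<delta> powr (DIM('a) - e) < \<epsilon>"
    using eventually_happens'[OF trivial_limit_at_right_real
        eventually_conj[OF ev eventually_conj[OF eventually_at_right_less small]]] by blast
  have "measure lebesgue (\<Union>x\<in>S. cball x \<delta>) \<le> (\<Sum>x\<in>S. measure lebesgue (cball x \<delta>))"
    by (rule measure_UNION_le) (use S in auto)
  also have "\<dots> = card S * (?V * \<delta> ^ DIM('a))"
    using \<delta> by (simp add: content_cball)
  also have "\<dots> \<le> C * \<delta> powr (- e) * (?V * \<delta> ^ DIM('a))"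
    using S \<delta> by (intro mult_right_mono) auto
  also have "\<dots> = C * ?V * \<delta> powr (DIM('a) - e)"
    using \<delta> by (simp add: powr_realpow[symmetric] powr_diff powr_minus divide_inverse)
  also have "\<dots> < \<epsilon>" by fact
  finally show "\<exists>T. A \<subseteq> T \<and> T \<in> lmeasurable \<and> measure lebesgue T < \<epsilon>"
    using S by (intro exI[of _ "\<Union>x\<in>S. cball x \<delta>"]) auto
qed

section \<open>From box dimension to covering rates\<close>

lemma log_enat_less_imp_card_le:
  assumes "0 < \<delta>" "\<delta> < 1" "log_enat m / ereal (- ln \<delta>) < ereal c" "enat j \<le> m"
  shows "real j \<le> \<delta> powr (- c)"
proof -
  have ln: "- ln \<delta> > 0" using assms by simp
  show ?thesis
  proof (cases m)
    case (enat i)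
    show ?thesis
    proof (cases "i = 0")
      case False
      then have "ln (real i) / (- ln \<delta>) < c"
        using assms(3) enat ln by (simp add: log_enat_def)
      then have "ln (real i) < - c * ln \<delta>"
        using ln by (simp add: field_simps)
      then have "real i < exp (- c * ln \<delta>)"
        using False by (metis exp_less_cancel_iff exp_ln of_nat_0_less_iff neq0_conv)
      then show ?thesis
        using assms enat by (simp add: powr_def)
    qed (use assms enat in auto)
  next
    case infinity
    then show ?thesis using assms(3) ln by (simp add: log_enat_def ereal_divide_eq)
  qed
qed

text \<open>Doubling the radii of a largest packing gives a cover: a point outside the doubled balls
  could be added as a further centre.\<close>

lemma covering_rate_upper_box_dim:
  fixes A :: "'a::metric_space set"
  assumes "upper_box_dim A < ereal c"
  shows "covering_rate c A"
proof (rule covering_rate_rescale[of 2 1])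
  have "\<forall>\<^sub>F \<delta> in at_right (0::real). \<delta> < 1"
    by (rule eventually_at_right_real[THEN eventually_mono]) auto
  moreover have "\<forall>\<^sub>F \<delta> in at_right 0. log_enat (packing_number A \<delta>) / ereal (- ln \<delta>) < ereal c"
    using assms unfolding upper_box_dim_def by (rule Limsup_lessD)
  ultimately show "\<forall>\<^sub>F \<delta> in at_right 0. \<exists>S. finite S \<and> real (card S) \<le> 1 * \<delta> powr (- c) \<and>
      A \<subseteq> (\<Union>x\<in>S. cball x (2 * \<delta>))"
    using eventually_at_right_less
  proof eventually_elim
    case (elim \<delta>)
    define P where "P S \<longleftrightarrow> finite S \<and> S \<subseteq> A \<and> pairwise (\<lambda>x y. disjnt (ball x \<delta>) (ball y \<delta>)) S" for S
    have le: "real (card S) \<le> \<delta> powr (- c)" if "P S" for S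
    proof (rule log_enat_less_imp_card_le)
      show "enat (card S) \<le> packing_number A \<delta>"
        unfolding packing_number_def using that by (intro SUP_upper) (auto simp: P_def)
    qed (use elim in auto)
    \<comment> \<open>A packing of greatest cardinality exists because the empty one qualifies and
      all cardinalities are bounded by \<open>\<delta> powr (- c)\<close>.\<close>
    have "P {}" by (simp add: P_def)
    moreover have "\<forall>S. P S \<longrightarrow> card S \<le> nat \<lfloor>\<delta> powr (- c)\<rfloor>"
      using le by (simp add: le_nat_floor)
    ultimately obtain S where S: "P S" "\<And>T. P T \<Longrightarrow> card T \<le> card S"
      using ex_has_greatest_nat[of P "{}" card] by (metis le_imp_less_Suc)
    have "x \<in> (\<Union>x\<in>S. cball x (2 * \<delta>))" if "x \<in> A" for x
    proof (rule ccontr)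
      assume x: "x \<notin> (\<Union>x\<in>S. cball x (2 * \<delta>))"
      have disj: "disjnt (ball x \<delta>) (ball y \<delta>)" if "y \<in> S" for y
      proof (rule ccontr)
        assume "\<not> disjnt (ball x \<delta>) (ball y \<delta>)"
        then obtain z where "dist x z < \<delta>" "dist y z < \<delta>" by (auto simp: disjnt_iff)
        then have "dist y x < 2 * \<delta>" using dist_triangle2[of y x z] by linarith
        then show False using x that by force
      qed
      have "x \<notin> S" using x elim by force
      moreover have "P (insert x S)"
        using S(1) disj \<open>x \<in> A\<close> by (auto simp: P_def pairwise_insert disjnt_sym)
      ultimately show False
        using S(2)[of "insert x S"] S(1) by (simp add: P_def)
    qed
    then show ?case
      using S(1) le[OF S(1)] by (intro exI[of _ S]) (auto simp: P_def)
  qed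
qed auto

section \<open>Countable unions of pieces with a covering rate\<close>

text \<open>\<open>X\<close> and \<open>M\<close> may be unbounded, and the Lipschitz constants of
  the charts of \<open>M\<close> need not be uniform. Countable unions allow for both and still
  preserve null sets.\<close>

definition sigma_covering_rate :: "real \<Rightarrow> 'a::metric_space set \<Rightarrow> bool"
  where "sigma_covering_rate e A \<longleftrightarrow>
    (\<exists>\<A>. countable \<A> \<and> A \<subseteq> \<Union>\<A> \<and> (\<forall>B\<in>\<A>. covering_rate e B))"

lemma sigma_covering_rate_box_dim:
  fixes X :: "'a::real_normed_vector set"
  assumes "has_box_dim X d" "d < ereal c"
  shows "sigma_covering_rate c X"
proof -
  have "covering_rate c (X \<inter> ball 0 (real n))" for n
  proof (cases "bounded X")
    case True
    then have "upper_box_dim X < ereal c"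
      using assms by (simp add: has_box_dim_def bounded_has_box_dim_def)
    then show ?thesis
      by (blast intro: covering_rate_subset covering_rate_upper_box_dim)
  next
    case False
    then obtain e where "bounded_has_box_dim (X \<inter> ball 0 (real n)) e" "e \<le> d"
      using assms(1) unfolding has_box_dim_def by (metis bounded_ball open_ball)
    then have "upper_box_dim (X \<inter> ball 0 (real n)) < ereal c"
      using assms(2) by (auto simp: bounded_has_box_dim_def)
    then show ?thesis by (rule covering_rate_upper_box_dim)
  qed
  moreover have "X \<subseteq> (\<Union>n. X \<inter> ball 0 (real n))"
    using reals_Archimedean2 by auto
  ultimately show ?thesis
    unfolding sigma_covering_rate_def by (intro exI[of _ "range (\<lambda>n. X \<inter> ball 0 (real n))"]) auto
qed

text \<open>A continuous derivative is bounded on a compact ball, and the ball is convex, so the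
  mean value inequality applies.\<close>

lemma C1_on_locally_lipschitz:
  fixes g :: "'a::euclidean_space \<Rightarrow> 'b::real_normed_vector"
  assumes "C1_on g V" "open V" "q \<in> V"
  obtains r L where "r > 0" "cball q r \<subseteq> V" "L-lipschitz_on (cball q r) g"
proof -
  obtain g' where g': "\<And>x. x \<in> V \<Longrightarrow> (g has_derivative blinfun_apply (g' x)) (at x)"
    and cont: "continuous_on V g'"
    using assms(1) unfolding C1_on_def by auto
  obtain r where r: "r > 0" "cball q r \<subseteq> V"
    using assms(2,3) open_contains_cball by blast
  have "bounded (g' ` cball q r)"
    using cont r(2) by (intro compact_imp_bounded compact_continuous_image)
      (auto intro: continuous_on_subset)
  then obtain B where B: "B > 0" "\<And>x. x \<in> cball q r \<Longrightarrow> norm (g' x) \<le> B"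
    by (auto simp: bounded_pos)
  have "B-lipschitz_on (cball q r) g"
  proof (rule lipschitz_onI)
    fix x y assume "x \<in> cball q r" "y \<in> cball q r"
    moreover have "(g has_derivative blinfun_apply (g' z)) (at z within cball q r)"
      if "z \<in> cball q r" for z
      using that r(2) g' by (blast intro: has_derivative_at_withinI)
    ultimately have "norm (g x - g y) \<le> B * norm (x - y)"
      using B(2) by (intro differentiable_bound[of "cball q r" g "\<lambda>x. blinfun_apply (g' x)"])
        (auto simp flip: norm_blinfun.rep_eq)
    then show "dist (g x) (g y) \<le> B * dist x y" by (simp add: dist_norm)
  qed (use B in simp)
  then show ?thesis using r that by blast
qed

text \<open>Locally \<open>M\<close> lies in the image of a bounded piece of a
  \<open>k\<close>-dimensional subspace under an inverse chart, which is Lipschitz on a small ball.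
  The Lindelof property leaves countably many such pieces.\<close>

lemma sigma_covering_rate_submanifold:
  fixes M :: "'a::euclidean_space set"
  assumes "submanifold k M"
  shows "sigma_covering_rate k M"
proof -
  have "\<exists>W. open W \<and> p \<in> W \<and> covering_rate k (M \<inter> W)" if "p \<in> M" for p
  proof -
    obtain U V f g and L :: "'a set" where p: "p \<in> U" and C1: "C1_diffeomorphism U V f g"
      and L: "subspace L" "dim L = k" and f: "f ` (M \<inter> U) = L \<inter> V"
      using assms \<open>p \<in> M\<close> unfolding submanifold_def by blast
    have hom: "homeomorphism U V f g" and UV: "open U" "open V" "C1_on g V"
      using C1 by (auto simp: C1_diffeomorphism_def)
    have "f p \<in> V" using hom p by (auto simp: homeomorphism_def)
    then obtain r K where r: "r > 0" "cball (f p) r \<subseteq> V" "K-lipschitz_on (cball (f p) r) g"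
      using C1_on_locally_lipschitz UV by blast
    \<comment> \<open>\<open>W\<close> is the part of \<open>U\<close> that the chart sends into the
      ball where \<open>g\<close> is Lipschitz.\<close>
    define W where "W = U \<inter> f -` ball (f p) r"
    have "open W"
      unfolding W_def using hom UV by (intro continuous_open_preimage) (auto simp: homeomorphism_def)
    moreover have "p \<in> W" using p r by (simp add: W_def)
    moreover have "covering_rate k (M \<inter> W)"
    proof (rule covering_rate_subset)
      have "L \<inter> cball (f p) r \<subseteq> L \<inter> cball 0 (norm (f p) + r)"
      proof
        fix x assume x: "x \<in> L \<inter> cball (f p) r"
        then have "norm x \<le> norm (f p) + r"
          using norm_triangle_ineq2[of x "f p"] by (auto simp: dist_norm norm_minus_commute)
        then show "x \<in> L \<inter> cball 0 (norm (f p) + r)" using x by simp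
      qed
      then have "covering_rate k (L \<inter> cball (f p) r)"
        using covering_rate_subset[OF covering_rate_bounded_subspace[OF L(1)]] L(2) by blast
      then show "covering_rate k (g ` (L \<inter> cball (f p) r))"
        by (rule covering_rate_lipschitz_image) (rule lipschitz_on_subset[OF r(3)], auto)
      show "M \<inter> W \<subseteq> g ` (L \<inter> cball (f p) r)"
      proof
        fix x assume x: "x \<in> M \<inter> W"
        then have "f x \<in> L" "g (f x) = x"
          using f hom by (auto simp: W_def homeomorphism_def)
        then show "x \<in> g ` (L \<inter> cball (f p) r)"
          using x by (intro image_eqI[of _ _ "f x"]) (auto simp: W_def)
      qed
    qed
    ultimately show ?thesis by blast
  qed
  then obtain W where W: "\<And>p. p \<in> M \<Longrightarrow> open (W p)" "\<And>p. p \<in> M \<Longrightarrow> p \<in> W p"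
      "\<And>p. p \<in> M \<Longrightarrow> covering_rate k (M \<inter> W p)"
    by metis
  obtain \<F> where \<F>: "\<F> \<subseteq> W ` M" "countable \<F>" "\<Union>\<F> = \<Union>(W ` M)"
    by (rule Lindelof[of "W ` M"]) (use W(1) in auto)
  have "M \<subseteq> \<Union>((\<inter>) M ` \<F>)" using \<F>(3) W(2) by blast
  then show ?thesis
    unfolding sigma_covering_rate_def
  proof (intro exI conjI ballI)
    show "countable ((\<inter>) M ` \<F>)" using \<F>(2) by simp
    fix B assume "B \<in> (\<inter>) M ` \<F>"
    then obtain p where "p \<in> M" "B = M \<inter> W p" using \<F>(1) by blast
    then show "covering_rate k B" using W(3) by blast
  qed
qed

text \<open>On each product of pieces the rates add up to less than the dimension of the target, so
  its image is null. Only countably many products occur.\<close>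

lemma negligible_lipschitz_image:
  fixes F :: "'a::euclidean_space \<times> 'b::heine_borel \<times> 'c::heine_borel \<Rightarrow> 'd::euclidean_space"
  assumes "sigma_covering_rate a A" "sigma_covering_rate b B"
    and "countable \<T>" "\<And>I. I \<in> \<T> \<Longrightarrow> covering_rate c I"
    and "a + (b + c) < DIM('d)"
    and "\<And>P Q I. bounded P \<Longrightarrow> bounded Q \<Longrightarrow> I \<in> \<T> \<Longrightarrow> \<exists>L. L-lipschitz_on (P \<times> Q \<times> I) F"
  shows "negligible (F ` (A \<times> B \<times> \<Union>\<T>))"
proof -
  obtain \<A> where \<A>: "countable \<A>" "A \<subseteq> \<Union>\<A>" "\<And>P. P \<in> \<A> \<Longrightarrow> covering_rate a P"
    using assms(1) unfolding sigma_covering_rate_def by blast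
  obtain \<B> where \<B>: "countable \<B>" "B \<subseteq> \<Union>\<B>" "\<And>P. P \<in> \<B> \<Longrightarrow> covering_rate b P"
    using assms(2) unfolding sigma_covering_rate_def by blast
  have "negligible (\<Union>(P, Q, I)\<in>\<A> \<times> \<B> \<times> \<T>. F ` (P \<times> Q \<times> I))"
  proof (rule negligible_countable_Union)
    show "countable ((\<lambda>(P, Q, I). F ` (P \<times> Q \<times> I)) ` (\<A> \<times> \<B> \<times> \<T>))"
      using \<A>(1) \<B>(1) assms(3) by auto
    fix S assume "S \<in> (\<lambda>(P, Q, I). F ` (P \<times> Q \<times> I)) ` (\<A> \<times> \<B> \<times> \<T>)"
    then obtain P Q I where S: "S = F ` (P \<times> Q \<times> I)" "P \<in> \<A>" "Q \<in> \<B>" "I \<in> \<T>" by auto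
    obtain L where "L-lipschitz_on (P \<times> Q \<times> I) F"
      using assms(6) covering_rate_bounded \<A>(3) \<B>(3) S by metis
    then have "covering_rate (a + (b + c)) S"
      unfolding S(1) using \<A>(3) \<B>(3) assms(4) S
      by (blast intro: covering_rate_lipschitz_image covering_rate_Times)
    then show "negligible S" using assms(5) by (rule negligible_covering_rate)
  qed
  moreover have "F ` (A \<times> B \<times> \<Union>\<T>) \<subseteq> (\<Union>(P, Q, I)\<in>\<A> \<times> \<B> \<times> \<T>. F ` (P \<times> Q \<times> I))"
  proof clarify
    fix x y z I assume "x \<in> A" "y \<in> B" "z \<in> I" "I \<in> \<T>"
    moreover then obtain P Q where "P \<in> \<A>" "x \<in> P" "Q \<in> \<B>" "y \<in> Q"
      using \<A>(2) \<B>(2) by blast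
    ultimately show "F (x, y, z) \<in> (\<Union>(P, Q, I)\<in>\<A> \<times> \<B> \<times> \<T>. F ` (P \<times> Q \<times> I))"
      by (intro UN_I[of "(P, Q, I)"]) auto
  qed
  ultimately show ?thesis by (rule negligible_subset)
qed

subsection \<open>Paths of rotations\<close>

text \<open>The normal need not be a unit vector. For \<open>u = 0\<close> the quotient is 0 by
  convention and the map is the identity, so involution and orthogonality hold for every
  \<open>u\<close>.\<close>

definition hyperplane_reflection :: "'a::real_inner \<Rightarrow> 'a \<Rightarrow> 'a"
  where "hyperplane_reflection u x = x - (2 * (u \<bullet> x) / (u \<bullet> u)) *\<^sub>R u"

text \<open>Lipschitz dependence on \<open>t\<close>, rather than mere continuity, makes the motion
  Lipschitz on bounded pieces, as the covering count requires. The starting point is left free, so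
  that constant paths at a reflection are included.\<close>

definition isometry_path :: "(real \<Rightarrow> 'a::real_inner \<Rightarrow> 'a) \<Rightarrow> bool"
  where "isometry_path R \<longleftrightarrow> (\<forall>t\<in>{0..1}. orthogonal_transformation (R t)) \<and>
    (\<exists>C\<ge>0. \<forall>s\<in>{0..1}. \<forall>t\<in>{0..1}. \<forall>x. norm (R s x - R t x) \<le> C * \<bar>s - t\<bar> * norm x)"

lemma orthogonal_transformation_diff:
  "orthogonal_transformation f \<Longrightarrow> f (x - y) = f x - f y"
  by (simp add: linear_diff orthogonal_transformation_linear)

lemma hyperplane_reflection_involution:
  "hyperplane_reflection u (hyperplane_reflection u x) = x"
  by (cases "u = 0")
    (auto simp: hyperplane_reflection_def inner_diff_right field_simps simp flip: scaleR_diff_left)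

lemma hyperplane_reflection_scaleR:
  "c \<noteq> 0 \<Longrightarrow> hyperplane_reflection (c *\<^sub>R u) x = hyperplane_reflection u x"
  by (simp add: hyperplane_reflection_def)

lemma orthogonal_transformation_hyperplane_reflection:
  "orthogonal_transformation (hyperplane_reflection u)"
  unfolding orthogonal_transformation_def
proof
  show "linear (hyperplane_reflection u)"
    unfolding hyperplane_reflection_def
    by (rule linearI) (simp_all add: inner_add_right algebra_simps add_divide_distrib)
  show "\<forall>v w. hyperplane_reflection u v \<bullet> hyperplane_reflection u w = v \<bullet> w"
    by (cases "u = 0")
      (auto simp: hyperplane_reflection_def inner_diff_right inner_diff_left inner_commute field_simps)
qed

lemma isometry_path_const:
  "orthogonal_transformation f \<Longrightarrow> isometry_path (\<lambda>t. f)"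
  unfolding isometry_path_def by (auto intro: exI[of _ 0])

text \<open>Compare both values with \<open>R t (Q s x)\<close>; since all maps preserve norms, the
  two constants add.\<close>

lemma isometry_path_compose:
  assumes "isometry_path R" "isometry_path Q"
  shows "isometry_path (\<lambda>t x. R t (Q t x))"
proof -
  obtain C D where C: "C \<ge> 0" "\<And>s t x. s \<in> {0..1} \<Longrightarrow> t \<in> {0..1} \<Longrightarrow>
        norm (R s x - R t x) \<le> C * \<bar>s - t\<bar> * norm x"
    and D: "D \<ge> 0" "\<And>s t x. s \<in> {0..1} \<Longrightarrow> t \<in> {0..1} \<Longrightarrow>
        norm (Q s x - Q t x) \<le> D * \<bar>s - t\<bar> * norm x"
    using assms unfolding isometry_path_def by metis
  have R: "orthogonal_transformation (R t)" and Q: "orthogonal_transformation (Q t)" if "t \<in> {0..1}" for t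
    using assms that unfolding isometry_path_def by auto
  have "norm (R s (Q s x) - R t (Q t x)) \<le> (C + D) * \<bar>s - t\<bar> * norm x"
    if st: "s \<in> {0..1}" "t \<in> {0..1}" for s t x
  proof -
    have "norm (R s (Q s x) - R t (Q t x)) \<le>
        norm (R s (Q s x) - R t (Q s x)) + norm (R t (Q s x - Q t x))"
      using norm_triangle_ineq[of "R s (Q s x) - R t (Q s x)" "R t (Q s x - Q t x)"]
      by (simp add: orthogonal_transformation_diff R[OF st(2)])
    also have "\<dots> \<le> C * \<bar>s - t\<bar> * norm x + D * \<bar>s - t\<bar> * norm x"
      using C(2)[OF st, of "Q s x"] D(2)[OF st, of x]
      by (simp add: orthogonal_transformation_norm R[OF st(2)] Q[OF st(1)])
    finally show ?thesis by (simp add: algebra_simps)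
  qed
  moreover have "orthogonal_transformation (\<lambda>x. R t (Q t x))" if "t \<in> {0..1}" for t
    using orthogonal_transformation_compose[OF R[OF that] Q[OF that]] by (simp add: o_def)
  ultimately show ?thesis
    unfolding isometry_path_def using C(1) D(1) by (auto intro!: exI[of _ "C + D"])
qed

text \<open>For unit normals the formula is quadratic in the normal, and the difference telescopes
  into two terms, each controlled by \<open>norm (u - w)\<close>.\<close>

lemma norm_hyperplane_reflection_diff_le:
  fixes u w x :: "'a::real_inner"
  assumes "norm u = 1" "norm w = 1"
  shows "norm (hyperplane_reflection u x - hyperplane_reflection w x) \<le> 4 * norm (u - w) * norm x"
proof -
  have "hyperplane_reflection u x - hyperplane_reflection w x
      = (-2) *\<^sub>R (((u - w) \<bullet> x) *\<^sub>R u + (w \<bullet> x) *\<^sub>R (u - w))"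
    using assms by (simp add: hyperplane_reflection_def norm_eq_1 algebra_simps inner_diff_left)
  also have "norm \<dots> \<le> 2 * (\<bar>(u - w) \<bullet> x\<bar> + \<bar>w \<bullet> x\<bar> * norm (u - w))"
    using assms norm_triangle_ineq[of "((u - w) \<bullet> x) *\<^sub>R u" "(w \<bullet> x) *\<^sub>R (u - w)"] by simp
  also have "\<dots> \<le> 2 * (norm (u - w) * norm x + norm x * norm (u - w))"
    using assms Cauchy_Schwarz_ineq2[of "u - w" x] Cauchy_Schwarz_ineq2[of w x]
    by (intro mult_left_mono add_mono mult_right_mono) auto
  finally show ?thesis by (simp add: algebra_simps)
qed

lemma norm_sgn_diff_le:
  fixes a b :: "'a::real_normed_vector"
  assumes "c > 0" "norm a \<ge> c" "norm b \<ge> c"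
  shows "norm (sgn a - sgn b) \<le> 2 / c * norm (a - b)"
proof -
  have a: "norm a > 0" "norm b > 0" using assms by linarith+
  have "(norm b - norm a) / norm a * inverse (norm b) = inverse (norm a) - inverse (norm b)"
    using a by (simp add: field_simps)
  then have "sgn a - sgn b = (a - b) /\<^sub>R norm a + ((norm b - norm a) / norm a) *\<^sub>R sgn b"
    by (simp add: sgn_div_norm scaleR_diff_left scaleR_diff_right)
  also have "norm \<dots> \<le> norm (a - b) / norm a + \<bar>norm b - norm a\<bar> / norm a"
    using a by (auto intro!: norm_triangle_le simp: norm_sgn divide_inverse mult.commute abs_mult)
  also have "\<dots> \<le> norm (a - b) / c + norm (a - b) / c"
    using a assms norm_triangle_ineq3[of a b] by (intro add_mono frac_le) auto
  finally show ?thesis by (simp add: field_simps)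
qed

text \<open>Reflecting twice in \<open>w\<close> is the identity. Turning one of the two mirrors
  from \<open>w\<close> to \<open>u\<close> while the other stays fixed gives the path.\<close>

lemma isometry_path_two_reflections:
  fixes u w :: "'a::real_inner"
  assumes "u \<noteq> 0" "w \<noteq> 0"
  obtains R where "isometry_path R" "\<And>x. R 0 x = x"
    "\<And>x. R 1 x = hyperplane_reflection u (hyperplane_reflection w x)"
proof -
  text \<open>Reflecting in \<open>-u\<close> is the same as reflecting in \<open>u\<close>, so the angle between the mirrors may
    be taken acute, and then the segment from \<open>w\<close> to \<open>u\<close> misses the origin.\<close>
  obtain v where v: "v \<noteq> 0" "v \<bullet> w \<ge> 0" "hyperplane_reflection v = hyperplane_reflection u"
  proof (cases "u \<bullet> w \<ge> 0")
    case False
    then show ?thesis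
      using that[of "- u"] assms hyperplane_reflection_scaleR[of "-1" u] by auto
  qed (use that assms in blast)
  define p where "p t = (1 - t) *\<^sub>R w + t *\<^sub>R v" for t :: real
  have "continuous_on {0..1} (\<lambda>t. norm (p t))"
    unfolding p_def by (intro continuous_intros)
  then obtain t0 where t0: "t0 \<in> {0..1}" "\<And>t. t \<in> {0..1} \<Longrightarrow> norm (p t0) \<le> norm (p t)"
    using continuous_attains_inf[of "{0..1::real}" "\<lambda>t. norm (p t)"] by auto
  \<comment> \<open>Pairing \<open>p t\<close> with \<open>w\<close> and with \<open>v\<close> gives
    sums of nonnegative terms. If they vanished, both \<open>1 - t\<close> and \<open>t\<close>
    would have to be 0.\<close>
  have p0: "p t \<noteq> 0" if t: "t \<in> {0..1}" for t
  proof
    assume "p t = 0"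
    then have "(p t \<bullet> w) = 0" "p t \<bullet> v = 0" by auto
    moreover have "p t \<bullet> w = (1 - t) * (w \<bullet> w) + t * (v \<bullet> w)"
      "p t \<bullet> v = (1 - t) * (v \<bullet> w) + t * (v \<bullet> v)"
      by (simp_all add: p_def inner_add_left inner_add_right inner_commute)
    moreover have "(1 - t) * (w \<bullet> w) \<ge> 0" "t * (v \<bullet> w) \<ge> 0" "(1 - t) * (v \<bullet> w) \<ge> 0" "t * (v \<bullet> v) \<ge> 0"
      using t v by auto
    ultimately have "(1 - t) * (w \<bullet> w) = 0" "t * (v \<bullet> v) = 0" by linarith+
    then show False using assms v by simp
  qed
  \<comment> \<open>The least norm on the segment is positive, which makes \<open>sgn\<close>
    Lipschitz along it.\<close>
  define c where "c = norm (p t0)"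
  have c: "c > 0" "\<And>t. t \<in> {0..1} \<Longrightarrow> norm (p t) \<ge> c"
    using p0[OF t0(1)] t0 by (auto simp: c_def)
  define Q where "Q t = hyperplane_reflection (sgn (p t))" for t
  have "isometry_path Q"
    unfolding isometry_path_def
  proof (intro conjI ballI exI allI)
    show "orthogonal_transformation (Q t)" for t
      unfolding Q_def by (rule orthogonal_transformation_hyperplane_reflection)
    show "4 * (2 / c * norm (w - v)) \<ge> 0" using c by simp
    fix s t :: real and x assume st: "s \<in> {0..1}" "t \<in> {0..1}"
    have "norm (Q s x - Q t x) \<le> 4 * norm (sgn (p s) - sgn (p t)) * norm x"
      unfolding Q_def using p0 st by (intro norm_hyperplane_reflection_diff_le) (auto simp: norm_sgn)
    also have "\<dots> \<le> 4 * (2 / c * norm (p s - p t)) * norm x"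
      using c st by (intro mult_right_mono mult_left_mono norm_sgn_diff_le) auto
    also have "p s - p t = (t - s) *\<^sub>R (w - v)"
      by (simp add: p_def algebra_simps)
    finally show "norm (Q s x - Q t x) \<le> 4 * (2 / c * norm (w - v)) * \<bar>s - t\<bar> * norm x"
      by (simp add: mult_ac abs_minus_commute)
  qed
  then have "isometry_path (\<lambda>t x. Q t (hyperplane_reflection w x))"
    by (rule isometry_path_compose)
      (intro isometry_path_const orthogonal_transformation_hyperplane_reflection)
  moreover have "Q 0 = hyperplane_reflection w" "Q 1 = hyperplane_reflection u"
    using assms v hyperplane_reflection_scaleR[of "inverse (norm w)" w]
      hyperplane_reflection_scaleR[of "inverse (norm v)" v]
    by (auto simp: Q_def p_def sgn_div_norm fun_eq_iff)
  ultimately show ?thesis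
    by (intro that[of "\<lambda>t x. Q t (hyperplane_reflection w x)"])
      (auto simp: hyperplane_reflection_involution)
qed

subsection \<open>Generic rotations and translations\<close>

text \<open>Lipschitz maps are bounded on a bounded set, so the product rule estimate has finite
  constants.\<close>

lemma lipschitz_on_scaleR_bounded:
  fixes f :: "'a::heine_borel \<Rightarrow> real" and g :: "'a \<Rightarrow> 'b::real_normed_vector"
  assumes "bounded S" "L-lipschitz_on S f" "K-lipschitz_on S g"
  shows "\<exists>C. C-lipschitz_on S (\<lambda>x. f x *\<^sub>R g x)"
proof (cases "S = {}")
  case False
  have bdd: "bounded (h ` S)" if "D-lipschitz_on S h" for D and h :: "'a \<Rightarrow> 'c::real_normed_vector"
  proof -
    obtain a where "a \<in> S" using False by auto
    obtain B where B: "\<And>x. x \<in> S \<Longrightarrow> dist a x \<le> B" using assms(1) bounded_any_center[of S a] by auto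
    have "dist (h a) (h x) \<le> D * B" if "x \<in> S" for x
    proof -
      have "dist (h a) (h x) \<le> D * dist a x"
        using lipschitz_onD \<open>D-lipschitz_on S h\<close> \<open>a \<in> S\<close> that by blast
      also have "\<dots> \<le> D * B"
        using B[OF that] lipschitz_on_nonneg[OF \<open>D-lipschitz_on S h\<close>] by (rule mult_left_mono)
      finally show ?thesis .
    qed
    then show ?thesis unfolding bounded_def by blast
  qed
  obtain a b where a: "a > 0" "\<And>x. x \<in> S \<Longrightarrow> \<bar>f x\<bar> \<le> a" and b: "b > 0" "\<And>x. x \<in> S \<Longrightarrow> norm (g x) \<le> b"
    using bdd[OF assms(2)] bdd[OF assms(3)] by (auto simp: bounded_pos)
  have "(a * K + L * b)-lipschitz_on S (\<lambda>x. f x *\<^sub>R g x)"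
  proof (rule lipschitz_onI)
    fix x y assume xy: "x \<in> S" "y \<in> S"
    have "dist (f x *\<^sub>R g x) (f y *\<^sub>R g y) \<le> norm (f x *\<^sub>R (g x - g y)) + norm ((f x - f y) *\<^sub>R g y)"
      unfolding dist_norm
      using norm_triangle_ineq[of "f x *\<^sub>R (g x - g y)" "(f x - f y) *\<^sub>R g y"]
      by (simp add: algebra_simps)
    also have "\<dots> = \<bar>f x\<bar> * dist (g x) (g y) + dist (f x) (f y) * norm (g y)"
      by (simp add: dist_norm)
    also have "\<dots> \<le> a * (K * dist x y) + (L * dist x y) * b"
      using a b xy lipschitz_onD[OF assms(2) xy] lipschitz_onD[OF assms(3) xy]
        lipschitz_on_nonneg[OF assms(2)]
      by (intro add_mono mult_mono) auto
    finally show "dist (f x *\<^sub>R g x) (f y *\<^sub>R g y) \<le> (a * K + L * b) * dist x y"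
      by (simp add: algebra_simps)
  qed (use a b lipschitz_on_nonneg[OF assms(2)] lipschitz_on_nonneg[OF assms(3)] in auto)
  then show ?thesis by blast
qed auto

text \<open>The vectors \<open>v\<close> for which a path \<open>t \<mapsto> h (x, t) + v / q t\<close> with \<open>x \<in> M\<close> hits \<open>X\<close>.\<close>

lemma negligible_bad_vectors:
  fixes M X :: "'a::euclidean_space set" and q :: "real \<Rightarrow> real" and h :: "'a \<times> real \<Rightarrow> 'a"
  assumes "sigma_covering_rate a X" "sigma_covering_rate b M" "a + b + 1 < DIM('a)"
    and "countable \<T>" "\<And>I. I \<in> \<T> \<Longrightarrow> covering_rate 1 I"
    and q: "\<And>I. I \<in> \<T> \<Longrightarrow> \<exists>L. L-lipschitz_on I q"
    and h: "\<And>P I. bounded P \<Longrightarrow> I \<in> \<T> \<Longrightarrow> \<exists>L. L-lipschitz_on (P \<times> I) h"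
  shows "negligible {q t *\<^sub>R (z - h (x, t)) | z x t. z \<in> X \<and> x \<in> M \<and> t \<in> \<Union>\<T>}"
proof -
  \<comment> \<open>Solving \<open>z = h (x, t) + v / q t\<close> for \<open>v\<close> parametrises
    the bad vectors by \<open>X\<close>, \<open>M\<close> and the times.\<close>
  let ?F = "\<lambda>(z, x, t). q t *\<^sub>R (z - h (x, t))"
  have "negligible (?F ` (X \<times> M \<times> \<Union>\<T>))"
  proof (rule negligible_lipschitz_image[OF assms(1,2,4,5)])
    fix P Q :: "'a set" and I :: "real set" assume PQ: "bounded P" "bounded Q" "I \<in> \<T>"
    have "bounded I" using assms(5)[OF PQ(3)] by (rule covering_rate_bounded)
    obtain L where L: "L-lipschitz_on I q" using q PQ(3) by blast
    obtain K where K: "K-lipschitz_on (Q \<times> I) h" using h PQ by blast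
    have fst1: "1-lipschitz_on S fst" for S :: "('a \<times> 'a \<times> real) set"
      by (rule lipschitz_onI) (auto simp: dist_fst_le)
    have snd1: "1-lipschitz_on S snd" for S :: "('a \<times> 'a \<times> real) set"
      by (rule lipschitz_onI) (auto simp: dist_snd_le)
    have snd2: "1-lipschitz_on S snd" for S :: "('a \<times> real) set"
      by (rule lipschitz_onI) (auto simp: dist_snd_le)
    have "(K * 1)-lipschitz_on (P \<times> Q \<times> I) (\<lambda>p. h (snd p))"
      by (rule lipschitz_on_compose2[OF snd1]) (rule lipschitz_on_subset[OF K], auto)
    then have *: "(1 + K * 1)-lipschitz_on (P \<times> Q \<times> I) (\<lambda>p. fst p - h (snd p))"
      by (rule lipschitz_on_diff[OF fst1])
    have "(1 * 1)-lipschitz_on (P \<times> Q \<times> I) (\<lambda>p. snd (snd p))"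
      by (rule lipschitz_on_compose2[OF snd1 snd2])
    then have "(L * (1 * 1))-lipschitz_on (P \<times> Q \<times> I) (\<lambda>p. q (snd (snd p)))"
      by (rule lipschitz_on_compose2) (rule lipschitz_on_subset[OF L], auto)
    moreover have "bounded (P \<times> Q \<times> I)"
      using PQ \<open>bounded I\<close> by (intro bounded_Times)
    ultimately show "\<exists>L. L-lipschitz_on (P \<times> Q \<times> I) ?F"
      using lipschitz_on_scaleR_bounded[OF _ _ *] by (simp add: case_prod_beta)
  qed (use assms(3) in auto)
  then show ?thesis
    by (rule negligible_subset) force
qed

lemma negligible_obtain_notin:
  fixes S :: "'a::euclidean_space set"
  assumes "negligible S"
  obtains v where "v \<notin> S"
proof -
  have "S \<noteq> UNIV" using assms non_negligible_UNIV by blast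
  then show ?thesis using that by blast
qed

section \<open>Generic reflections and a rotation to the final position\<close>

text \<open>A reflection moves each point along its normal. A new coincidence therefore makes
  \<open>u\<close> a multiple of \<open>z - (q + A (x - p))\<close>, and such multiples form a null
  set by the count with one extra real parameter. The set \<open>N\<close> lets \<open>u\<close>
  avoid further prescribed vectors.\<close>

lemma avoiding_reflection:
  fixes M X :: "'a::euclidean_space set"
  assumes "sigma_covering_rate a X" "sigma_covering_rate b M" "a + b + 1 < DIM('a)"
    and "orthogonal_transformation A" "negligible N"
  obtains u where "u \<noteq> 0" "u \<notin> N"
    "\<And>x z. x \<in> M \<Longrightarrow> z \<in> X \<Longrightarrow> hyperplane_reflection u (A (x - p)) = z - q \<Longrightarrow>
       A (x - p) = z - q \<and> u \<bullet> (z - q) = 0"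
proof -
  let ?\<T> = "range (\<lambda>n. {- real n..real n})"
  \<comment> \<open>Here the weight is \<open>t\<close> itself, and \<open>h\<close> does not depend
    on time; writing \<open>fst (x, t)\<close> fits the set to the general form of bad
    vectors.\<close>
  let ?bad = "{t *\<^sub>R (z - (q + A (fst (x, t) - p))) | z x t. z \<in> X \<and> x \<in> M \<and> t \<in> \<Union>?\<T>}"
  have "negligible ?bad"
  proof (rule negligible_bad_vectors[OF assms(1-3), where h = "\<lambda>y. q + A (fst y - p)"])
    show "\<exists>L. L-lipschitz_on (P \<times> I) (\<lambda>y. q + A (fst y - p))" for P and I :: "real set"
    proof (intro exI lipschitz_onI)
      fix y y' :: "'a \<times> real"
      have "dist (q + A (fst y - p)) (q + A (fst y' - p)) = norm (A (fst y - fst y'))"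
        using orthogonal_transformation_diff[OF assms(4), of "fst y - p" "fst y' - p"]
        by (simp add: dist_norm)
      also have "\<dots> \<le> 1 * dist y y'"
        using dist_fst_le[of y y'] by (simp add: orthogonal_transformation_norm assms(4) dist_norm)
      finally show "dist (q + A (fst y - p)) (q + A (fst y' - p)) \<le> 1 * dist y y'" .
    qed auto
    show "\<exists>L. L-lipschitz_on I (\<lambda>t::real. t)" for I
      using lipschitz_on_id by blast
  qed (auto intro: covering_rate_Icc)
  then have "negligible (?bad \<union> N \<union> {0})"
    using assms(5) by auto
  then obtain u where "u \<notin> ?bad \<union> N \<union> {0}"
    by (rule negligible_obtain_notin)
  then have u: "u \<notin> ?bad" "u \<notin> N" "u \<noteq> 0"
    by (simp_all only: Un_iff singleton_iff de_Morgan_disj not_False_eq_True)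
  have T: "t \<in> \<Union>?\<T>" for t
    using real_arch_simple[of "\<bar>t\<bar>"] by (auto simp: abs_le_iff minus_le_iff)
  have "A (x - p) = z - q \<and> u \<bullet> (z - q) = 0"
    if xz: "x \<in> M" "z \<in> X" and eq: "hyperplane_reflection u (A (x - p)) = z - q" for x z
  proof -
    \<comment> \<open>The reflection displaces \<open>A (x - p)\<close> by
      \<open>c *\<^sub>R u\<close>. If \<open>c\<close> is nonzero, \<open>u\<close> is bad with
      parameter \<open>inverse c\<close>; if \<open>c = 0\<close>, the point lies on the
      mirror.\<close>
    define c where "c = - (2 * (u \<bullet> A (x - p)) / (u \<bullet> u))"
    have c: "z - (q + A (x - p)) = c *\<^sub>R u"
      using eq by (simp add: hyperplane_reflection_def c_def algebra_simps)
    have "c = 0"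
    proof (rule ccontr)
      assume "c \<noteq> 0"
      then have "u = inverse c *\<^sub>R (z - (q + A (fst (x, inverse c) - p)))"
        using c by simp
      then show False using u(1) xz T by blast
    qed
    then show ?thesis using c u(3) by (auto simp: c_def algebra_simps)
  qed
  then show ?thesis using that u by blast
qed

text \<open>A generic reflection matches a point of \<open>A (M - p)\<close> with one of \<open>X - q\<close> only if the two points
  agree already and lie on the mirror. Reflections are composed in pairs, to stay in a path
  from the identity, until their normals span the space and the mirrors meet in the origin alone.\<close>

lemma avoiding_rotation:
  fixes M X :: "'a::euclidean_space set"
  assumes "sigma_covering_rate a X" "sigma_covering_rate b M" "a + b + 1 < DIM('a)"
    and "q \<notin> X"
  obtains R where "isometry_path R" "\<And>x. R 0 x = x" "\<And>x. x \<in> M \<Longrightarrow> q + R 1 (x - p) \<notin> X"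
proof -
  \<comment> \<open>Here \<open>B\<close> collects normals of the reflections used so far. Every
    coincidence still present was there from the start and lies on all the mirrors normal to
    \<open>B\<close>.\<close>
  have "\<exists>R B. isometry_path R \<and> (\<forall>x. R 0 x = x) \<and> dim B \<ge> m \<and>
      (\<forall>x\<in>M. \<forall>z\<in>X. R 1 (x - p) = z - q \<longrightarrow> x - p = z - q \<and> (\<forall>b\<in>B. b \<bullet> (z - q) = 0))"
    if "m \<le> DIM('a)" for m
    using that
  proof (induction m)
    case 0
    have "isometry_path (\<lambda>t::real. \<lambda>x::'a. x)"
      by (intro isometry_path_const orthogonal_transformation_id)
    then show ?case by (intro exI[of _ "\<lambda>t x. x"] exI[of _ "{}"]) auto
  next
    case (Suc m)
    then obtain R B where R: "isometry_path R" "\<And>x. R 0 x = x" "dim B \<ge> m"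
      and IH: "\<And>x z. x \<in> M \<Longrightarrow> z \<in> X \<Longrightarrow> R 1 (x - p) = z - q \<Longrightarrow>
        x - p = z - q \<and> (\<forall>b\<in>B. b \<bullet> (z - q) = 0)"
      by (metis Suc_leD)
    have orth: "orthogonal_transformation (R 1)"
      using R(1) by (simp add: isometry_path_def)
    \<comment> \<open>While \<open>B\<close> does not span, its span is null and \<open>w\<close> is
      chosen outside it, so the dimension grows. Once \<open>B\<close> spans, there is nothing left
      to gain.\<close>
    define N where "N = (if dim B < DIM('a) then span B else {})"
    have "negligible N" by (simp add: N_def negligible_lowdim)
    then obtain w where w: "w \<noteq> 0" "w \<notin> N"
      "\<And>x z. x \<in> M \<Longrightarrow> z \<in> X \<Longrightarrow> hyperplane_reflection w (R 1 (x - p)) = z - q \<Longrightarrow>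
        R 1 (x - p) = z - q \<and> w \<bullet> (z - q) = 0"
      using avoiding_reflection[OF assms(1-3) orth] by blast
    have orth': "orthogonal_transformation (\<lambda>x. hyperplane_reflection w (R 1 x))"
      using orthogonal_transformation_compose[OF orthogonal_transformation_hyperplane_reflection orth]
      by (simp add: o_def)
    \<comment> \<open>The second reflection makes the number even; it need only create no new
      coincidence.\<close>
    obtain u where u: "u \<noteq> 0"
      "\<And>x z. x \<in> M \<Longrightarrow> z \<in> X \<Longrightarrow>
        hyperplane_reflection u (hyperplane_reflection w (R 1 (x - p))) = z - q \<Longrightarrow>
        hyperplane_reflection w (R 1 (x - p)) = z - q \<and> u \<bullet> (z - q) = 0"
      using avoiding_reflection[OF assms(1-3) orth' negligible_empty] by blast
    obtain Q where Q: "isometry_path Q" "\<And>x. Q 0 x = x"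
      "\<And>x. Q 1 x = hyperplane_reflection u (hyperplane_reflection w x)"
      using isometry_path_two_reflections[OF u(1) w(1)] by blast
    have "dim (insert w B) \<ge> Suc m"
    proof (cases "dim B < DIM('a)")
      case True
      then show ?thesis using w(2) R(3) by (simp add: N_def dim_insert)
    next
      case False
      then show ?thesis using Suc.prems dim_subset[OF subset_insertI[of B w]] by linarith
    qed
    moreover have "x - p = z - q \<and> (\<forall>b\<in>insert w B. b \<bullet> (z - q) = 0)"
      if "x \<in> M" "z \<in> X" "Q 1 (R 1 (x - p)) = z - q" for x z
      using that u(2)[OF that(1,2)] w(3)[OF that(1,2)] IH[OF that(1,2)] Q(3) by auto
    ultimately show ?case
      using isometry_path_compose[OF Q(1) R(1)] Q(2) R(2)
      by (intro exI[of _ "\<lambda>t x. Q t (R t x)"] exI[of _ "insert w B"]) auto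
  qed
  from this[OF order_refl] obtain R B where R: "isometry_path R" "\<And>x. R 0 x = x" "dim B \<ge> DIM('a)"
    and avoid: "\<And>x z. x \<in> M \<Longrightarrow> z \<in> X \<Longrightarrow> R 1 (x - p) = z - q \<Longrightarrow> (\<forall>b\<in>B. b \<bullet> (z - q) = 0)"
    by blast
  have "span B = UNIV"
    using R(3) dim_subset_UNIV[of B] dim_eq_full by (metis le_antisym)
  have "q + R 1 (x - p) \<notin> X" if "x \<in> M" for x
  proof
    define z where "z = q + R 1 (x - p)"
    assume "q + R 1 (x - p) \<in> X"
    then have z: "z \<in> X" "R 1 (x - p) = z - q" by (simp_all add: z_def)
    \<comment> \<open>A vector orthogonal to a spanning set is 0, so the coincidence would have
      \<open>z = q\<close>, against \<open>q \<notin> X\<close>.\<close>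
    then have "\<forall>b\<in>B. orthogonal (z - q) b"
      using avoid[OF that] by (simp add: orthogonal_def inner_commute)
    then have "orthogonal (z - q) (z - q)"
      using \<open>span B = UNIV\<close> orthogonal_to_span[of "z - q" B] by blast
    then show False using z assms(4) by (auto simp: orthogonal_self)
  qed
  then show ?thesis using that R by blast
qed

text \<open>For \<open>0 < t < 1\<close> the factor \<open>t * (1 - t)\<close> lets the bulge \<open>v\<close> move the point freely, while the
  two ends of the motion do not depend on \<open>v\<close>.\<close>

lemma avoiding_motion:
  fixes M X :: "'a::euclidean_space set"
  assumes "sigma_covering_rate a X" "sigma_covering_rate b M" "a + b + 1 < DIM('a)"
    and "M \<inter> X = {}" "q \<notin> X"
  obtains \<mu> where "motion M \<mu>" "\<And>x t. x \<in> M \<Longrightarrow> t \<in> {0..1} \<Longrightarrow> \<mu> (x, t) \<notin> X" "\<mu> (p, 1) = q"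
proof -
  obtain R where R: "isometry_path R" "\<And>x. R 0 x = x" "\<And>x. x \<in> M \<Longrightarrow> q + R 1 (x - p) \<notin> X"
    using avoiding_rotation[OF assms(1-3,5)] by blast
  obtain C where C: "C \<ge> 0"
    "\<And>s t x. s \<in> {0..1} \<Longrightarrow> t \<in> {0..1} \<Longrightarrow> norm (R s x - R t x) \<le> C * \<bar>s - t\<bar> * norm x"
    using R(1) unfolding isometry_path_def by metis
  have orth: "orthogonal_transformation (R t)" if "t \<in> {0..1}" for t
    using R(1) that by (simp add: isometry_path_def)
  \<comment> \<open>\<open>R t\<close> turns about \<open>p\<close> while the centre travels
    straight to \<open>q\<close>. Thus \<open>h (x, 0) = x\<close>, \<open>h (p, 1) = q\<close>, and
    at time 1 the image of \<open>M\<close> avoids \<open>X\<close>.\<close>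
  define h where "h = (\<lambda>(x, t::real). p + t *\<^sub>R (q - p) + R t (x - p))"
  \<comment> \<open>Only the distance of \<open>x\<close> from \<open>p\<close> enters. Bounding it
    gives a Lipschitz constant on bounded pieces; fixing \<open>x\<close> gives continuity on all of
    \<open>M\<close>, even if \<open>M\<close> is unbounded.\<close>
  have h_lip: "dist (h (x, s)) (h (y, t)) \<le> dist x y + (norm (q - p) + C * norm (x - p)) * dist s t"
    if st: "s \<in> {0..1}" "t \<in> {0..1}" for x y s t
  proof -
    have "h (x, s) - h (y, t) = (s - t) *\<^sub>R (q - p) + (R s (x - p) - R t (x - p)) + R t (x - y)"
      using orthogonal_transformation_diff[OF orth[OF st(2)], of "x - p" "y - p"]
      by (simp add: h_def algebra_simps)
    also have "norm \<dots> \<le> norm ((s - t) *\<^sub>R (q - p)) + norm (R s (x - p) - R t (x - p)) + norm (R t (x - y))"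
      by (intro norm_triangle_le add_mono norm_triangle_ineq order_refl)
    also have "\<dots> \<le> dist s t * norm (q - p) + C * dist s t * norm (x - p) + dist x y"
      using C(2)[OF st, of "x - p"] orth[OF st(2)]
      by (simp add: orthogonal_transformation_norm dist_norm)
    finally show ?thesis by (simp add: dist_norm algebra_simps)
  qed
  have h_lipschitz: "\<exists>L. L-lipschitz_on (P \<times> I) h" if P: "bounded P" and I: "I \<subseteq> {0..1}" for P I
  proof -
    obtain B where B: "B > 0" "\<And>x. x \<in> P \<Longrightarrow> dist p x \<le> B"
    proof -
      obtain B where "\<And>x. x \<in> P \<Longrightarrow> dist p x \<le> B"
        using P bounded_any_center[of P p] by blast
      then show ?thesis by (intro that[of "max B 1"]) (auto simp: le_max_iff_disj)
    qed
    have "(1 + (norm (q - p) + C * B))-lipschitz_on (P \<times> I) h"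
    proof (rule lipschitz_onI, clarify)
      fix x s y t assume xy: "x \<in> P" "s \<in> I" "y \<in> P" "t \<in> I"
      have "norm (x - p) \<le> B" using B(2)[OF xy(1)] by (simp add: dist_norm norm_minus_commute)
      have "dist (h (x, s)) (h (y, t)) \<le> dist x y + (norm (q - p) + C * norm (x - p)) * dist s t"
        using h_lip xy I by blast
      also have "\<dots> \<le> dist (x, s) (y, t) + (norm (q - p) + C * B) * dist (x, s) (y, t)"
        using dist_fst_le[of "(x, s)" "(y, t)"] dist_snd_le[of "(x, s)" "(y, t)"] \<open>norm (x - p) \<le> B\<close> C(1) B(1)
        by (intro add_mono mult_mono) (auto intro: mult_left_mono)
      finally show "dist (h (x, s)) (h (y, t)) \<le> (1 + (norm (q - p) + C * B)) * dist (x, s) (y, t)"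
        by (simp add: algebra_simps)
    qed (use C(1) B(1) in auto)
    then show ?thesis by blast
  qed
  have h_cont: "continuous_on (M \<times> {0..1}) h"
    unfolding continuous_on_def
  proof
    fix y :: "'a \<times> real" assume y: "y \<in> M \<times> {0..1}"
    have "((\<lambda>z. dist (fst y) (fst z) + (norm (q - p) + C * norm (fst y - p)) * dist (snd y) (snd z))
        \<longlongrightarrow> dist (fst y) (fst y) + (norm (q - p) + C * norm (fst y - p)) * dist (snd y) (snd y))
        (at y within M \<times> {0..1})"
      by (intro tendsto_intros)
    then have lim: "((\<lambda>z. dist (fst y) (fst z) + (norm (q - p) + C * norm (fst y - p)) * dist (snd y) (snd z))
        \<longlongrightarrow> 0) (at y within M \<times> {0..1})"
      by simp
    have bound: "\<forall>\<^sub>F z in at y within M \<times> {0..1}. dist (h z) (h y) \<le>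
        dist (fst y) (fst z) + (norm (q - p) + C * norm (fst y - p)) * dist (snd y) (snd z)"
      unfolding eventually_at_filter
    proof (intro always_eventually allI impI)
      fix z :: "'a \<times> real" assume "z \<in> M \<times> {0..1}"
      then show "dist (h z) (h y) \<le>
          dist (fst y) (fst z) + (norm (q - p) + C * norm (fst y - p)) * dist (snd y) (snd z)"
        using h_lip[of "snd y" "snd z" "fst y" "fst z"] y by (auto simp: dist_commute)
    qed
    have "((\<lambda>z. dist (h z) (h y)) \<longlongrightarrow> 0) (at y within M \<times> {0..1})"
      by (rule real_tendsto_sandwich[OF _ bound tendsto_const lim]) simp
    then show "(h \<longlongrightarrow> h y) (at y within M \<times> {0..1})"
      by (rule tendsto_dist_iff[THEN iffD2])
  qed
  \<comment> \<open>These intervals exhaust the open unit interval and stay away from its ends,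
    where \<open>?q\<close> blows up. The weight \<open>?q t\<close> equals
    \<open>1 / (t * (1 - t))\<close>, split so that two bounds for \<open>inverse\<close>
    suffice.\<close>
  let ?\<T> = "range (\<lambda>n. {1 / real (Suc n)..1 - 1 / real (Suc n)})"
  let ?q = "\<lambda>t::real. inverse t + inverse (1 - t)"
  have Icc: "I \<subseteq> {0..1}" if I: "I \<in> ?\<T>" for I
  proof -
    obtain n where "I = {1 / real (Suc n)..1 - 1 / real (Suc n)}" using I by auto
    moreover have "1 / real (Suc n) \<ge> 0" by simp
    ultimately show ?thesis by (auto simp del: of_nat_Suc)
  qed
  have "negligible {?q t *\<^sub>R (z - h (x, t)) | z x t. z \<in> X \<and> x \<in> M \<and> t \<in> \<Union>?\<T>}"
  proof (rule negligible_bad_vectors[OF assms(1-3)])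
    fix I assume "I \<in> ?\<T>"
    then obtain n where I: "I = {1 / real (Suc n)..1 - 1 / real (Suc n)}" by blast
    \<comment> \<open>On \<open>I\<close> both \<open>t\<close> and \<open>1 - t\<close> are at
      least \<open>1 / real (Suc n)\<close>, where \<open>inverse\<close> has Lipschitz constant
      \<open>real (Suc n) ^ 2\<close>; each summand contributes one such term.\<close>
    have "(real (Suc n) ^ 2 + real (Suc n) ^ 2)-lipschitz_on I ?q"
    proof (rule lipschitz_onI)
      have inv: "\<bar>inverse s - inverse t\<bar> \<le> real (Suc n) ^ 2 * \<bar>s - t\<bar>"
        if "s \<ge> 1 / real (Suc n)" "t \<ge> 1 / real (Suc n)" for s t :: real
      proof -
        have st: "s > 0" "t > 0" "inverse s \<le> real (Suc n)" "inverse t \<le> real (Suc n)"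
          using that le_imp_inverse_le[of "1 / real (Suc n)"]
          by (auto intro: less_le_trans[of 0 "1 / real (Suc n)"])
        have "inverse s - inverse t = inverse s * inverse t * (t - s)"
          using st by (simp add: field_simps)
        then have "\<bar>inverse s - inverse t\<bar> = (inverse s * inverse t) * \<bar>s - t\<bar>"
          using st by (simp add: abs_mult abs_minus_commute)
        also have "\<dots> \<le> (real (Suc n) * real (Suc n)) * \<bar>s - t\<bar>"
          using st by (intro mult_right_mono mult_mono) auto
        finally show ?thesis by (simp add: power2_eq_square)
      qed
      fix s t assume "s \<in> I" "t \<in> I"
      then have "\<bar>inverse s - inverse t\<bar> \<le> real (Suc n) ^ 2 * \<bar>s - t\<bar>"
        "\<bar>inverse (1 - s) - inverse (1 - t)\<bar> \<le> real (Suc n) ^ 2 * \<bar>s - t\<bar>"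
        using inv[of s t] inv[of "1 - s" "1 - t"] by (auto simp: I abs_minus_commute)
      then show "dist (?q s) (?q t) \<le> (real (Suc n) ^ 2 + real (Suc n) ^ 2) * dist s t"
        unfolding dist_real_def distrib_right by linarith
    qed simp
    then show "\<exists>L. L-lipschitz_on I ?q" by blast
  qed (use h_lipschitz Icc in \<open>auto intro: covering_rate_Icc\<close>)
  then obtain v where v: "v \<notin> {?q t *\<^sub>R (z - h (x, t)) | z x t. z \<in> X \<and> x \<in> M \<and> t \<in> \<Union>?\<T>}"
    by (rule negligible_obtain_notin)
  define \<mu> where "\<mu> y = h y + (snd y * (1 - snd y)) *\<^sub>R v" for y
  have "\<mu> (x, t) \<notin> X" if x: "x \<in> M" and t: "t \<in> {0..1}" for x t
  proof -
    consider "t = 0" | "t = 1" | "0 < t" "t < 1" using t by fastforce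
    then show ?thesis
    proof cases
      case 1
      then show ?thesis using assms(4) x R(2) by (auto simp: \<mu>_def h_def)
    next
      case 2
      then show ?thesis using R(3)[OF x] by (simp add: \<mu>_def h_def add.commute)
    next
      case 3
      obtain n where n: "inverse (real (Suc n)) < min t (1 - t)"
        using reals_Archimedean[of "min t (1 - t)"] 3 by auto
      then have "t \<in> \<Union>?\<T>"
        by (auto simp: inverse_eq_divide intro!: exI[of _ n])
      show ?thesis
      proof
        assume "\<mu> (x, t) \<in> X"
        \<comment> \<open>Since \<open>?q t\<close> is the reciprocal of the bulge factor, a hit at
          time \<open>t\<close> recovers \<open>v\<close> as a bad vector.\<close>
        moreover have "v = ?q t *\<^sub>R (\<mu> (x, t) - h (x, t))"
        proof -
          have "?q t * (t * (1 - t)) = 1" using 3 by (simp add: field_simps)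
          then show ?thesis by (simp add: \<mu>_def)
        qed
        ultimately show False using v x \<open>t \<in> \<Union>?\<T>\<close> by blast
      qed
    qed
  qed
  moreover have "motion M \<mu>"
    unfolding motion_def
  proof (intro conjI ballI)
    show "continuous_on (M \<times> {0..1}) \<mu>"
      unfolding \<mu>_def by (intro continuous_intros h_cont)
    show "\<mu> (x, 0) = x" for x using R(2) by (simp add: \<mu>_def h_def)
    show "dist (\<mu> (x, t)) (\<mu> (y, t)) = dist x y" if "t \<in> {0..1}" for x y t
      using orthogonal_transformation_diff[OF orth[OF that], of "x - p" "y - p"]
        orthogonal_transformation_norm[OF orth[OF that], of "x - y"]
      by (simp add: \<mu>_def h_def dist_norm)
  qed
  moreover have "\<mu> (p, 1) = q"
    using linear_0[OF orthogonal_transformation_linear[OF orth[of 1]]] by (simp add: \<mu>_def h_def)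
  ultimately show ?thesis using that by blast
qed

theorem theorem2p2:
  fixes M X :: "(real ^ 'n) set" and k :: nat and d :: ereal
  assumes "submanifold k M"
    and "has_box_dim X d"
    and "d < ereal (real CARD('n) - real k - 1)"
    and "M \<inter> X = {}"
  shows "(\<exists>\<mu>. motion M \<mu> \<and> (\<forall>x\<in>M. \<forall>t\<in>{0..1}. \<mu> (x, t) \<notin> X)) \<and>
    (\<forall>x0\<in>M. \<forall>y0. y0 \<notin> X \<longrightarrow>
      (\<exists>\<mu>. motion M \<mu> \<and> (\<forall>x\<in>M. \<forall>t\<in>{0..1}. \<mu> (x, t) \<notin> X) \<and> \<mu> (x0, 1) = y0))"
proof (intro conjI ballI allI impI)
  have "motion M fst"
    by (auto simp: motion_def intro!: continuous_intros)
  then show "\<exists>\<mu>. motion M \<mu> \<and> (\<forall>x\<in>M. \<forall>t\<in>{0..1}. \<mu> (x, t) \<notin> X)"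
    using assms(4) by (intro exI[of _ fst]) auto
next
  fix x0 y0 assume "y0 \<notin> X"
  \<comment> \<open>Covering rates are real, while \<open>d\<close> may be
    \<open>-\<infinity>\<close>. A real number strictly between \<open>d\<close> and the bound
    serves as a rate for \<open>X\<close> and leaves the count strict.\<close>
  obtain c where c: "d < ereal c" "ereal c < ereal (real CARD('n) - real k - 1)"
    using ereal_dense2[OF assms(3)] by blast
  have "c + real k + 1 < DIM(real ^ 'n)" using c(2) by simp
  then show "\<exists>\<mu>. motion M \<mu> \<and> (\<forall>x\<in>M. \<forall>t\<in>{0..1}. \<mu> (x, t) \<notin> X) \<and> \<mu> (x0, 1) = y0"
    using avoiding_motion[OF sigma_covering_rate_box_dim[OF assms(2) c(1)]
        sigma_covering_rate_submanifold[OF assms(1)] _ assms(4) \<open>y0 \<notin> X\<close>]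
    by (metis (no_types, lifting))
qed

end
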